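(* Let $G=(V,E)$ be a graph with no isolated vertices, let $n\geq |V(G)|$ be an integer, and let $m=|E(G)|-1$. Then $$ \mathrm{sat}(n, \mathcal{B}(G))= \begin{cases} |E(G)|, & \mbox{ if } G \mbox{ is a star with at least four edges},\\ |E(G)| -1, & \mbox{ otherwise.} \end{cases}$$ Moreover, if $G_1$ is a star with at least $4$ edges on $t$ vertices and $G_2$ is any other graph (with no isolated vertices), then $\mathcal{H}_t(n)$ is a Berge-$G_1$ saturated hypergraph and $\mathcal{H}(n,m)$ (with $m=|E(G_2)|-1$) is a Berge-$G_2$ saturated hypergraph.
   Context: Hypergraphs are finite, with hyperedges being distinct subsets of the vertex set of size at least $2$. For a graph $G$, a hypergraph $H$ is called Berge-$G$ if there is a hypergraph $H'$ isomorphic to $H$ with $V(G)\subseteq V(H')$ and a bijection $\phi:E(G)\to E(H')$ with $e\subseteq\phi(e)$ for every $e\in E(G)$. $\mathcal{B}(G)$ denotes the set of all Berge-$G$ hypergraphs. A hypergraph $\mathcal{H}$ is Berge-$G$ saturated ($\mathcal{B}(G)$ saturated) if it contains no subhypergraph isomorphic to a member of $\mathcal{B}(G)$, but adding to $\mathcal{H}$ any new hyperedge (a subset of $V(\mathcal{H})$ of size at least $2$ not already a hyperedge) creates such a subhypergraph. For $n\geq|V(G)|$, $\mathrm{sat}(n,\mathcal{B}(G))$ is the minimum number of hyperedges of a $\mathcal{B}(G)$ saturated hypergraph on $n$ vertices. Write $[n]=\{1,\dots,n\}$. Construction $\mathcal{H}_t(n)$ (for positive integers $t\le n$): the hypergraph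 on vertex set $[n]$ with hyperedges $[n],\ [n]\setminus\{1\},\ [n]\setminus\{2\},\ \ldots,\ [n]\setminus\{t-3\},\ [t-3]$. Construction $\mathcal{H}(n,m)$ (for positive integers $n,m$ with $m\le\binom{n}{2}$): let $x=\min\{m-1,n\}$; let $V'$ be a set of $x$ singletons $\{i\}$, $i\in[n]$; let $E'$ be the edge set of an almost regular graph (vertex degrees differ by at most one) on vertex set $[n]$ with $|E'|=m-x-1$; let $H'(n,m)=\{\varnothing\}\cup V'\cup E'$. Then $\mathcal{H}(n,m)$ is the hypergraph on $[n]$ with hyperedge set $\{[n]\setminus X : X\in H'(n,m)\}$ (it has $m$ hyperedges). *)

theory Defs
  imports Main
begin

definition simple_graph :: "'a set \<Rightarrow> 'a set set \<Rightarrow> bool" where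
  "simple_graph V E \<longleftrightarrow> finite V \<and> (\<forall>e\<in>E. e \<subseteq> V \<and> card e = 2)"

definition no_isolated :: "'a set \<Rightarrow> 'a set set \<Rightarrow> bool" where
  "no_isolated V E \<longleftrightarrow> (\<forall>v\<in>V. \<exists>e\<in>E. v \<in> e)"

definition is_star :: "'a set \<Rightarrow> 'a set set \<Rightarrow> bool" where
  "is_star V E \<longleftrightarrow> (\<exists>c\<in>V. \<forall>e\<in>E. c \<in> e)"

definition contains_Berge :: "'a set \<Rightarrow> 'a set set \<Rightarrow> 'b set \<Rightarrow> 'b set set \<Rightarrow> bool" where
  "contains_Berge V E HV HE \<longleftrightarrow>
     (\<exists>f \<phi>. inj_on f V \<and> f ` V \<subseteq> HV \<and> inj_on \<phi> E \<and> \<phi> ` E \<subseteq> HE \<and>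
            (\<forall>e\<in>E. f ` e \<subseteq> \<phi> e))"

definition is_hypergraph :: "nat \<Rightarrow> nat set set \<Rightarrow> bool" where
  "is_hypergraph n HE \<longleftrightarrow> (\<forall>S\<in>HE. S \<subseteq> {1..n} \<and> 2 \<le> card S)"

definition Berge_saturated :: "nat \<Rightarrow> 'a set \<Rightarrow> 'a set set \<Rightarrow> nat set set \<Rightarrow> bool" where
  "Berge_saturated n V E HE \<longleftrightarrow>
     is_hypergraph n HE \<and> \<not> contains_Berge V E {1..n} HE \<and>
     (\<forall>S. S \<subseteq> {1..n} \<and> 2 \<le> card S \<and> S \<notin> HE \<longrightarrow> contains_Berge V E {1..n} (insert S HE))"

definition sat :: "nat \<Rightarrow> 'a set \<Rightarrow> 'a set set \<Rightarrow> nat" where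
  "sat n V E = (LEAST k. \<exists>HE. Berge_saturated n V E HE \<and> card HE = k)"

definition H_t :: "nat \<Rightarrow> nat \<Rightarrow> nat set set" where
  "H_t t n = {{1..n}} \<union> {{1..n} - {i} | i. i \<in> {1..t-3}} \<union> {{1..t-3}}"

definition Hnm_x :: "nat \<Rightarrow> nat \<Rightarrow> nat" where
  "Hnm_x n m = min (m - 1) n"

definition almost_regular_on :: "nat \<Rightarrow> nat set set \<Rightarrow> bool" where
  "almost_regular_on n E' \<longleftrightarrow>
     (\<forall>e\<in>E'. e \<subseteq> {1..n} \<and> card e = 2) \<and>
     (\<forall>u\<in>{1..n}. \<forall>v\<in>{1..n}.
        card {e\<in>E'. u \<in> e} \<le> card {e\<in>E'. v \<in> e} + 1)"

definition valid_Hnm_choice :: "nat \<Rightarrow> nat \<Rightarrow> nat set set \<Rightarrow> nat set set \<Rightarrow> bool" where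
  "valid_Hnm_choice n m V' E' \<longleftrightarrow>
     V' \<subseteq> {{i} | i. i \<in> {1..n}} \<and> card V' = Hnm_x n m \<and>
     almost_regular_on n E' \<and> card E' = m - Hnm_x n m - 1"

definition Hnm :: "nat \<Rightarrow> nat set set \<Rightarrow> nat set set \<Rightarrow> nat set set" where
  "Hnm n V' E' = (\<lambda>X. {1..n} - X) ` ({{}} \<union> V' \<union> E')"

end

theory Submission
  imports Defs
begin

text \<open>Hyperedges of the second construction are recorded by their complements \<open>X\<close>, so an edge may be
  mapped to \<open>X\<close> iff it is disjoint from \<open>X\<close>. Given a new
  hyperedge \<open>S\<close>, one edge is placed inside \<open>S\<close> and the others are assigned by Hall's theorem. Since
  stars have at most \<open>n - 1\<close> edges and two different pairs jointly cover at most \<open>n\<close> edges, the only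
  possible violation of Hall's condition is one complement covering all remaining edges; the
  placement is chosen to avoid this.

  For a star Hall's theorem is applied the other way round, from the hyperedges through a candidate
  centre to the leaves.\<close>

subsection \<open>Hall's theorem\<close>

text \<open>A hypergraph with \<open>card E - 1\<close> hyperedges gains only one from
  \<open>S\<close>, so a Berge copy must use every hyperedge. Hence no complement may be met by all
  edges other than the one placed in \<open>S\<close>, and this dictates where the copy goes. A
  singleton \<open>{p}\<close> violates this only when \<open>p\<close> is the image of a vertex
  common to all other edges, which is the source of the threshold four: from four edges on, a graph
  that turns into a star under every single deletion is itself a star, while with three edges there
  is at most one singleton complement, and even a star can dodge it.

  A Berge star has its centre in every hyperedge it uses. The \<open>card E\<close> hyperedges of
  \<open>H_t\<close> have empty intersection, because a centre \<open>i\<close> in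
  \<open>{1..t-3}\<close> is excluded by \<open>{1..n} - {i}\<close> and any other centre by
  \<open>{1..t-3}\<close>. So there is no copy, but once a new hyperedge arrives one old hyperedge
  may be discarded.\<close>

lemma hall_marriage:
  assumes "finite A" and "\<And>a. a \<in> A \<Longrightarrow> finite (R a)"
    and "\<And>J. J \<subseteq> A \<Longrightarrow> card J \<le> card (\<Union> (R ` J))"
  shows "\<exists>\<phi>. inj_on \<phi> A \<and> (\<forall>a\<in>A. \<phi> a \<in> R a)"
  using assms
proof (induction "card A" arbitrary: A R rule: less_induct)
  case less
  note fin = less.prems(1) and finR = less.prems(2) and hall = less.prems(3)
  show ?case
  proof (cases "A = {}")
    case True
    then show ?thesis by simp
  next
    case False
    then obtain a where a: "a \<in> A" by blast
    \<comment> \<open>A proper subfamily \<open>J\<close> with exactly \<open>card J\<close>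
      available values must use all of them, so it is matched first and its values are withdrawn
      from the rest. If there is no such \<open>J\<close>, every nonempty proper subfamily has a
      value to spare, and an arbitrary choice \<open>b\<close> for \<open>a\<close> does no
      harm.\<close>
    show ?thesis
    proof (cases "\<exists>J. J \<subset> A \<and> J \<noteq> {} \<and> card (\<Union> (R ` J)) = card J")
      case True
      then obtain J where J: "J \<subset> A" "J \<noteq> {}" "card (\<Union> (R ` J)) = card J" by blast
      let ?U = "\<Union> (R ` J)"
      have finJ: "finite J" using J(1) fin by (meson finite_subset psubset_imp_subset)
      have finU: "finite ?U" using finJ finR J(1) by blast
      have "\<exists>f. inj_on f J \<and> (\<forall>x\<in>J. f x \<in> R x)"
      proof (rule less.hyps)
        show "card J < card A" using J(1) fin by (rule psubset_card_mono[rotated])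
        show "card K \<le> card (\<Union> (R ` K))" if "K \<subseteq> J" for K using that J(1) by (intro hall) auto
      qed (use finJ finR J(1) in auto)
      then obtain f where f: "inj_on f J" "\<forall>x\<in>J. f x \<in> R x" by blast
      have lt: "card (A - J) < card A"
        using J(1,2) fin finJ by (intro psubset_card_mono) auto
      have hallU: "card K \<le> card (\<Union> ((\<lambda>x. R x - ?U) ` K))" if K: "K \<subseteq> A - J" for K
      proof -
        have fK: "finite K" using K fin by (meson finite_Diff finite_subset)
        have "card K + card J = card (K \<union> J)"
          using K fK finJ by (intro card_Un_disjoint[symmetric]) auto
        also have "\<dots> \<le> card (\<Union> (R ` (K \<union> J)))" using K J(1) by (intro hall) auto
        also have "\<Union> (R ` (K \<union> J)) = \<Union> ((\<lambda>x. R x - ?U) ` K) \<union> ?U" by auto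
        also have "card \<dots> \<le> card (\<Union> ((\<lambda>x. R x - ?U) ` K)) + card ?U" by (rule card_Un_le)
        finally show ?thesis using J(3) by simp
      qed
      have "\<exists>g. inj_on g (A - J) \<and> (\<forall>x\<in>A - J. g x \<in> R x - ?U)"
        by (rule less.hyps) (use lt fin finR hallU in auto)
      then obtain g where g: "inj_on g (A - J)" "\<forall>x\<in>A - J. g x \<in> R x - ?U" by blast
      let ?h = "\<lambda>x. if x \<in> J then f x else g x"
      have "inj_on ?h (J \<union> (A - J))"
      proof (subst inj_on_Un, intro conjI)
        show "inj_on ?h J" using f(1) by (simp cong: inj_on_cong)
        show "inj_on ?h (A - J)" using g(1) by (auto simp: inj_on_def)
        show "?h ` (J - (A - J)) \<inter> ?h ` (A - J - J) = {}" using f(2) g(2) by auto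
      qed
      moreover have "J \<union> (A - J) = A" using J(1) by auto
      ultimately have "inj_on ?h A" by simp
      moreover have "\<forall>x\<in>A. ?h x \<in> R x" using f g by auto
      ultimately show ?thesis by blast
    next
      case False
      have "card {a} \<le> card (\<Union> (R ` {a}))" using a by (intro hall) auto
      then obtain b where b: "b \<in> R a" by fastforce
      have lt: "card (A - {a}) < card A" using a fin by (meson card_Diff1_less)
      have hallb: "card K \<le> card (\<Union> ((\<lambda>x. R x - {b}) ` K))" if K: "K \<subseteq> A - {a}" for K
      proof (cases "K = {}")
        case False
        have "K \<subset> A" using K a by auto
        then have "card (\<Union> (R ` K)) \<noteq> card K" "card K \<le> card (\<Union> (R ` K))"
          using \<open>\<not> (\<exists>J. _ J)\<close> False hall by auto
        then have "card K \<le> card (\<Union> (R ` K)) - 1" by simp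
        also have "\<dots> \<le> card (\<Union> (R ` K) - {b})" by (simp add: card_Diff_singleton_if)
        also have "\<Union> (R ` K) - {b} = \<Union> ((\<lambda>x. R x - {b}) ` K)" by auto
        finally show ?thesis .
      qed simp
      have "\<exists>g. inj_on g (A - {a}) \<and> (\<forall>x\<in>A - {a}. g x \<in> R x - {b})"
        by (rule less.hyps) (use lt fin finR hallb in auto)
      then obtain g where g: "inj_on g (A - {a})" "\<forall>x\<in>A - {a}. g x \<in> R x - {b}" by blast
      have "inj_on (g(a := b)) A" using g unfolding inj_on_def by auto
      moreover have "\<forall>x\<in>A. (g(a := b)) x \<in> R x" using g b by auto
      ultimately show ?thesis by blast
    qed
  qed
qed

subsection \<open>Vertex covers of size at most two\<close>

lemma doubleton_eqI: "card e = 2 \<Longrightarrow> c \<in> e \<Longrightarrow> d \<in> e \<Longrightarrow> c \<noteq> d \<Longrightarrow> e = {c, d}"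
  by (auto simp: card_2_iff)

lemma card_star_le:
  assumes "finite V" and "\<And>e. e \<in> A \<Longrightarrow> e \<subseteq> V \<and> card e = 2 \<and> c \<in> e"
  shows "card A \<le> card (V - {c})"
proof -
  have "A \<subseteq> (\<lambda>x. {c, x}) ` (V - {c})"
  proof
    fix e assume "e \<in> A"
    then have "e \<subseteq> V" "card e = 2" "c \<in> e" using assms(2) by auto
    then obtain x where "e = {c, x}" "x \<noteq> c" by (metis card_2_iff doubleton_eq_iff insertE singletonD)
    then show "e \<in> (\<lambda>x. {c, x}) ` (V - {c})" using \<open>e \<subseteq> V\<close> by auto
  qed
  then show ?thesis using assms(1) by (meson finite_Diff surj_card_le)
qed

text \<open>Disjoint pairs leave only the four edges between \<open>P\<close> and \<open>Q\<close>,
  and \<open>P \<union> Q\<close> already has four vertices. If the pairs share \<open>i\<close>, an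
  edge avoiding \<open>i\<close> must join the two other ends, so at most one edge is added to the
  at most \<open>card V - 1\<close> edges at \<open>i\<close>.\<close>

lemma card_two_covers_le:
  assumes V: "finite V" and A: "\<And>e. e \<in> A \<Longrightarrow> e \<subseteq> V \<and> card e = 2"
    and P: "P \<subseteq> V" "card P = 2" and Q: "Q \<subseteq> V" "card Q = 2" and "P \<noteq> Q"
    and cov: "\<And>e. e \<in> A \<Longrightarrow> e \<inter> P \<noteq> {} \<and> e \<inter> Q \<noteq> {}"
  shows "card A \<le> card V"
proof (cases "P \<inter> Q = {}")
  case True
  have fin: "finite P" "finite Q" using P Q V finite_subset by auto
  have "A \<subseteq> (\<lambda>(x, y). {x, y}) ` (P \<times> Q)"
  proof
    fix e assume e: "e \<in> A"
    from cov[OF e] obtain x y where xy: "x \<in> e" "x \<in> P" "y \<in> e" "y \<in> Q" by auto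
    then have "x \<noteq> y" using True by auto
    then have "e = {x, y}" using A[OF e] xy by (auto simp: card_2_iff)
    then show "e \<in> (\<lambda>(x, y). {x, y}) ` (P \<times> Q)" using xy by auto
  qed
  then have "card A \<le> card (P \<times> Q)" using fin by (intro surj_card_le) auto
  also have "\<dots> = card (P \<union> Q)" using True P Q fin by (simp add: card_Un_disjoint)
  also have "\<dots> \<le> card V" using P Q V by (intro card_mono) auto
  finally show ?thesis .
next
  case False
  then obtain i where i: "i \<in> P" "i \<in> Q" by auto
  obtain j where j: "P = {i, j}" "j \<noteq> i" using P i by (auto simp: card_2_iff)
  obtain k where k: "Q = {i, k}" "k \<noteq> i" using Q i by (auto simp: card_2_iff)
  have jk: "j \<noteq> k" using j k \<open>P \<noteq> Q\<close> by auto
  have "e = {j, k}" if "e \<in> A" "i \<notin> e" for e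
    using that cov[of e] A[of e] jk unfolding j k by (auto simp: card_2_iff)
  then have sub: "A \<subseteq> insert {j, k} {e \<in> A. i \<in> e}" by auto
  have fA: "finite A" using A V by (meson Pow_iff finite_Pow_iff finite_subset subsetI)
  have "card A \<le> card (insert {j, k} {e \<in> A. i \<in> e})" using sub fA by (intro card_mono) auto
  also have "\<dots> \<le> Suc (card {e \<in> A. i \<in> e})" by (rule card_insert_le_m1) auto
  also have "\<dots> \<le> Suc (card (V - {i}))" using card_star_le[OF V, of "{e \<in> A. i \<in> e}" i] A by auto
  also have "\<dots> = card V" using V P i by (metis card_Suc_Diff1 subsetD)
  finally show ?thesis .
qed

text \<open>\<open>F\<close> is meant as the embedded graph without the edge placed in the new
  hyperedge. There are exactly as many complements as edges of \<open>F\<close>, so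
  \<open>nocov\<close> is Hall's condition for the whole family; for proper subfamilies the counts
  suffice.\<close>

lemma exists_avoiding_assignment:
  assumes N: "finite N" and F: "\<And>e. e \<in> F \<Longrightarrow> e \<subseteq> N \<and> card e = 2" and "F \<noteq> {}"
    and V': "\<And>X. X \<in> V' \<Longrightarrow> X \<subseteq> N \<and> card X = 1" "card V' = min (card F - 1) (card N)"
    and E': "\<And>X. X \<in> E' \<Longrightarrow> X \<subseteq> N \<and> card X = 2" "card V' + card E' + 1 = card F"
    and nocov: "\<And>X. X \<in> V' \<union> E' \<Longrightarrow> \<exists>e\<in>F. e \<inter> X = {}"
  shows "\<exists>\<phi>. inj_on \<phi> F \<and> (\<forall>e\<in>F. \<phi> e \<in> insert {} (V' \<union> E') \<and> e \<inter> \<phi> e = {})"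
proof -
  let ?X = "insert {} (V' \<union> E')"
  let ?R = "\<lambda>e. {X \<in> ?X. e \<inter> X = {}}"
  have fin: "finite F" "finite V'" "finite E'"
    using N F V'(1) E'(1) by (meson Pow_iff finite_Pow_iff finite_subset subsetI)+
  have "V' \<inter> E' = {}" "{} \<notin> V' \<union> E'" using V'(1) E'(1) by fastforce+
  then have cX: "card ?X = card F" using fin E'(2) by (simp add: card_Un_disjoint)
  have "card A \<le> card (\<Union> (?R ` A))" if A: "A \<subseteq> F" for A
  proof (cases "A = {} \<or> A = F")
    case True
    then show ?thesis
    proof
      assume "A = F"
      moreover have "?X \<subseteq> \<Union> (?R ` F)" using nocov \<open>F \<noteq> {}\<close> by auto
      moreover have "card ?X \<le> card (\<Union> (?R ` F))"
        using \<open>?X \<subseteq> _\<close> fin by (intro card_mono) auto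
      ultimately show ?thesis using cX by simp
    qed simp
  next
    case False
    let ?C = "{X \<in> V' \<union> E'. \<forall>e\<in>A. e \<inter> X \<noteq> {}}"
    have fA: "finite A" using A fin finite_subset by blast
    have ltA: "card A < card F" using A False fin by (meson psubsetI psubset_card_mono)
    have "\<Union> (?R ` A) = ?X - ?C" using False by auto
    then have RC: "card (\<Union> (?R ` A)) = card F - card ?C"
      using cX fin by (simp add: card_Diff_subset subset_insertI2 subset_iff)
    let ?CV = "{X \<in> V'. \<forall>e\<in>A. e \<inter> X \<noteq> {}}" and ?CE = "{X \<in> E'. \<forall>e\<in>A. e \<inter> X \<noteq> {}}"
    obtain e where e: "e \<in> A" using False by blast
    then have eN: "card e = 2" "e \<subseteq> N" using A F by auto
    then obtain a b where ab: "e = {a, b}" "a \<noteq> b" by (auto simp: card_2_iff)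
    have N2: "2 \<le> card N" using card_mono[OF N eN(2)] eN(1) by simp
    have single: "\<exists>c\<in>N. X = {c}" if "X \<in> V'" for X
      using V'(1)[OF that] by (auto simp: card_1_singleton_iff)
    have CV1: "card ?CV \<le> 1" if "card A \<ge> 2"
    proof -
      have "\<exists>e'. e' \<in> A \<and> e' \<noteq> e"
      proof (rule ccontr)
        assume "\<not> ?thesis"
        then have "A = {e}" using e by blast
        then show False using that by simp
      qed
      then obtain e' where e': "e' \<in> A" "e' \<noteq> e" by blast
      have "X = Y" if XY: "X \<in> ?CV" "Y \<in> ?CV" for X Y
      proof (rule ccontr)
        assume "X \<noteq> Y"
        obtain c where c: "X = {c}" using single[of X] XY(1) by blast
        obtain d where d: "Y = {d}" using single[of Y] XY(2) by blast
        have "h = {c, d}" if "h \<in> A" for h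
          using that XY A F c d \<open>X \<noteq> Y\<close> by (intro doubleton_eqI) auto
        then show False using e e' by metis
      qed
      then show ?thesis using fin(2) by (simp add: card_le_Suc0_iff_eq)
    qed
    have CV0: "card ?CV = 0" if "card A \<ge> card N"
    proof -
      have False if X: "X \<in> ?CV" for X
      proof -
        from X obtain c where c: "c \<in> N" "X = {c}" using single by blast
        then have "card A \<le> card (N - {c})" using X A F by (intro card_star_le[OF N]) auto
        then show False using \<open>card A \<ge> card N\<close> c(1) N by (metis card_Diff1_less leD order_trans)
      qed
      then have "?CV = {}" by blast
      then show ?thesis by (simp only: card.empty)
    qed
    have "?CV \<subseteq> {{a}, {b}}" using e ab single by fastforce
    then have "card ?CV \<le> card {{a}, {b}}" by (intro card_mono) auto
    also have "\<dots> \<le> 2" by (simp add: card_insert_if)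
    finally have CV2: "card ?CV \<le> 2" .
    have CE1: "card ?CE \<le> 1" if "card A > card N"
    proof -
      have "X = Y" if "X \<in> ?CE" "Y \<in> ?CE" for X Y
      proof (rule ccontr)
        assume "X \<noteq> Y"
        then have "card A \<le> card N"
          using that A F E'(1) by (intro card_two_covers_le[OF N, of A X Y]) auto
        then show False using \<open>card A > card N\<close> by simp
      qed
      then show ?thesis using fin(3) by (simp add: card_le_Suc0_iff_eq)
    qed
    have le: "card ?CV \<le> card V'" "card ?CE \<le> card E'" using fin by (auto intro: card_mono)
    have "?C = ?CV \<union> ?CE" by auto
    then have C: "card ?C \<le> card ?CV + card ?CE" by (metis (no_types, lifting) card_Un_le)
    have A1: "card A \<ge> 1" using e fA by (metis One_nat_def Suc_leI card_gt_0_iff empty_iff)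
    \<comment> \<open>Without pairs, \<open>card F = card V' + 1\<close>: a single edge is settled
      by \<open>card ?CV \<le> card V'\<close>, several edges by \<open>card ?CV \<le> 1\<close>.
      With pairs, \<open>card F = card N + card E' + 1\<close>, and the bounds on \<open>?CV\<close>
      and \<open>?CE\<close> drop just in time as \<open>card A\<close> reaches 2,
      \<open>card N\<close> and \<open>card N + 1\<close>.\<close>
    have "card A + card ?C \<le> card F"
    proof (cases "card E' = 0")
      case True
      then show ?thesis using C le ltA CV1 A1 E'(2) by linarith
    next
      case False
      then have "card V' = card N" using V'(2) E'(2) by linarith
      then show ?thesis using C le ltA CV0 CV1 CV2 CE1 A1 N2 E'(2) by linarith
    qed
    then show ?thesis using RC by simp
  qed
  then show ?thesis using hall_marriage[of F ?R] fin by auto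
qed


text \<open>One vertex lies on at most \<open>card V - 1\<close> edges, and two distinct pairs
  jointly cover at most \<open>card V\<close>. A graph with more edges than vertices therefore pins
  down its small cover.\<close>

lemma cover_unique:
  assumes V: "finite V" and A: "\<And>e. e \<in> A \<Longrightarrow> e \<subseteq> V \<and> card e = 2"
    and P: "P \<subseteq> V" "card P \<le> 2" and Q: "Q \<subseteq> V" "card Q \<le> 2"
    and cov: "\<And>e. e \<in> A \<Longrightarrow> e \<inter> P \<noteq> {} \<and> e \<inter> Q \<noteq> {}" and lt: "card V < card A"
  shows "P = Q \<and> card P = 2"
proof -
  have two: "card X = 2" if X: "X \<subseteq> V" "card X \<le> 2" "\<And>e. e \<in> A \<Longrightarrow> e \<inter> X \<noteq> {}" for X
  proof (rule ccontr)
    assume "card X \<noteq> 2"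
    with X(2) consider "card X = 0" | "card X = 1" by linarith
    then show False
    proof cases
      case 1
      then have "X = {}" using X(1) V by (metis card_0_eq finite_subset)
      then have "A = {}" using X(3) by blast
      then show False using lt by simp
    next
      case 2
      then obtain c where c: "X = {c}" by (auto simp: card_1_singleton_iff)
      then have "card A \<le> card (V - {c})" using X(3) A by (intro card_star_le[OF V]) auto
      also have "\<dots> \<le> card V" using V by (intro card_mono) auto
      finally show False using lt by simp
    qed
  qed
  have "card P = 2" "card Q = 2" using two P Q cov by blast+
  moreover from this have "P = Q" using card_two_covers_le[OF V A P(1) _ Q(1)] cov lt by (meson leD)
  ultimately show ?thesis by simp
qed

text \<open>Carries covers of an embedded graph back to the abstract one, so that the edge to be
  placed in \<open>S\<close> can be chosen before the embedding. The bound is only an inequality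
  because \<open>X\<close> may contain points outside the image of \<open>f\<close>.\<close>

lemma cover_pullback:
  assumes "inj_on f V" and "\<forall>e\<in>A. e \<subseteq> V" and "finite X" and "\<forall>e\<in>A. f ` e \<inter> X \<noteq> {}"
  shows "\<exists>Y\<subseteq>V. card Y \<le> card X \<and> (\<forall>e\<in>A. e \<inter> Y \<noteq> {})"
proof (intro exI conjI)
  let ?Y = "{v \<in> V. f v \<in> X}"
  show "?Y \<subseteq> V" by auto
  show "card ?Y \<le> card X" using assms(1,3) by (intro card_inj_on_le[of f]) (auto simp: inj_on_def)
  show "\<forall>e\<in>A. e \<inter> ?Y \<noteq> {}"
  proof
    fix e assume "e \<in> A"
    then have "e \<subseteq> V" "f ` e \<inter> X \<noteq> {}" using assms(2,4) by auto
    then show "e \<inter> ?Y \<noteq> {}" by auto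
  qed
qed

subsection \<open>Embeddings leaving no complement as a cover\<close>

lemma inj_on_extension:
  assumes "finite V" "finite N" "card V \<le> card N" "W \<subseteq> V" "inj_on g W" "g ` W \<subseteq> N"
  obtains f where "inj_on f V" "f ` V \<subseteq> N" "\<And>x. x \<in> W \<Longrightarrow> f x = g x"
proof -
  have fW: "finite W" using assms finite_subset by blast
  have "card (V - W) = card V - card W" using assms fW by (simp add: card_Diff_subset)
  also have "\<dots> \<le> card N - card (g ` W)" using assms by (simp add: card_image)
  also have "\<dots> = card (N - g ` W)" using assms fW by (simp add: card_Diff_subset)
  finally obtain h where h: "h ` (V - W) \<subseteq> N - g ` W" "inj_on h (V - W)"
    using card_le_inj[of "V - W" "N - g ` W"] assms by auto
  let ?f = "\<lambda>x. if x \<in> W then g x else h x"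
  have "inj_on ?f (W \<union> (V - W))"
  proof (subst inj_on_Un, intro conjI)
    show "inj_on ?f W" using assms(5) by (simp cong: inj_on_cong)
    show "inj_on ?f (V - W)" using h(2) by (auto simp: inj_on_def)
    show "?f ` (W - (V - W)) \<inter> ?f ` (V - W - W) = {}" using h(1) by auto
  qed
  moreover have "W \<union> (V - W) = V" using assms(4) by auto
  moreover have "?f ` V \<subseteq> N" using h(1) assms(4,6) by auto
  ultimately show thesis by (intro that[of ?f]) auto
qed

lemma two_elements:
  assumes "2 \<le> card S" obtains u v where "u \<in> S" "v \<in> S" "u \<noteq> v"
proof -
  obtain T where "T \<subseteq> S" "card T = 2" using assms by (meson obtain_subset_with_card_n)
  then show thesis using that by (auto simp: card_2_iff)
qed

lemma exists_other_element: "2 \<le> card S \<Longrightarrow> \<exists>s\<in>S. s \<noteq> p"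
  using two_elements[of S] by metis

lemma exists_embedding_edge:
  assumes "finite V" "finite N" "card V \<le> card N" and "e \<subseteq> V" "card e = 2"
    and "S \<subseteq> N" "2 \<le> card S"
  obtains f where "inj_on f V" "f ` V \<subseteq> N" "f ` e \<subseteq> S"
proof -
  obtain T where T: "T \<subseteq> S" "card T = 2" using assms(7) by (meson obtain_subset_with_card_n)
  have "finite e" "finite T" using T assms by (auto intro: card_ge_0_finite)
  then obtain g where g: "bij_betw g e T" using T assms(5) by (metis finite_same_card_bij)
  then have "inj_on g e" "g ` e \<subseteq> N" using T assms(6) by (auto simp: bij_betw_def)
  then obtain f where f: "inj_on f V" "f ` V \<subseteq> N" "\<And>x. x \<in> e \<Longrightarrow> f x = g x"
    using inj_on_extension[OF assms(1-4)] by blast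
  then have "f ` e = T" using g by (auto simp: bij_betw_def)
  then show thesis using that f T by blast
qed

text \<open>If the centre \<open>c\<close> left after deleting \<open>e0\<close> misses
  \<open>e0\<close>, then deleting another edge \<open>e1\<close> leaves a different centre
  \<open>d\<close>. All edges besides \<open>e0\<close> and \<open>e1\<close> equal
  \<open>{c, d}\<close>, but with four edges there are at least two of them. The triangle shows that
  three edges are too few.\<close>

lemma exists_star_edge_deletion:
  assumes E: "\<And>e. e \<in> E \<Longrightarrow> card e = 2" and "4 \<le> card E" and del: "\<And>e0. e0 \<in> E \<Longrightarrow> \<exists>c. \<forall>e\<in>E - {e0}. c \<in> e"
  shows "\<exists>c. \<forall>e\<in>E. c \<in> e"
proof (rule ccontr)
  assume no: "\<not> ?thesis"
  have finE: "finite E" using assms(2) by (auto intro: card_ge_0_finite)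
  obtain e0 where e0: "e0 \<in> E" using assms(2) by fastforce
  then obtain c where c: "\<forall>e\<in>E - {e0}. c \<in> e" using del by blast
  have "c \<notin> e0" using no c by blast
  have "3 \<le> card (E - {e0})" using e0 assms(2) finE by simp
  then have "E - {e0} \<noteq> {}" by (metis card.empty not_numeral_le_zero)
  then obtain e1 where e1: "e1 \<in> E - {e0}" by blast
  then obtain d where d: "\<forall>e\<in>E - {e1}. d \<in> e" using del by blast
  have "c \<noteq> d" using d e0 e1 \<open>c \<notin> e0\<close> by blast
  have "2 \<le> card (E - {e0} - {e1})" using e1 \<open>3 \<le> _\<close> finE by simp
  then obtain h k where "h \<in> E - {e0} - {e1}" "k \<in> E - {e0} - {e1}" "h \<noteq> k" by (rule two_elements)
  moreover have "h = {c, d}" if "h \<in> E - {e0} - {e1}" for h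
    using that c d E \<open>c \<noteq> d\<close> by (intro doubleton_eqI) auto
  ultimately show False by metis
qed

text \<open>For three-edge graphs the only obstruction to Hall's condition is that the single one-element
  complement \<open>{p}\<close> is the image of the common vertex \<open>c\<close> of the two edges other than \<open>e0\<close>.\<close>
lemma exists_embedding_avoiding_point:
  assumes VN: "finite V" "finite N" "card V \<le> card N" and e0: "e0 \<subseteq> V" "card e0 = 2" and c: "c \<in> V"
    and S: "S \<subseteq> N" "2 \<le> card S" "S \<noteq> N - {p}"
  obtains f where "inj_on f V" "f ` V \<subseteq> N" "f ` e0 \<subseteq> S" "f c \<noteq> p"
proof (cases "c \<in> e0")
  case True
  then obtain b where b: "e0 = {c, b}" "b \<noteq> c" using e0(2) by (auto simp: card_2_iff)
  obtain s where s1: "s \<in> S" "s \<noteq> p" using exists_other_element[OF S(2)] by blast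
  then obtain s' where s2: "s' \<in> S" "s' \<noteq> s" using exists_other_element[OF S(2)] by blast
  note s = s1 s2
  define g where "g = (\<lambda>x. if x = c then s else s')"
  have "inj_on g {c, b}" "g ` {c, b} \<subseteq> N" using s S(1) b by (auto simp: g_def)
  then obtain f where "inj_on f V" "f ` V \<subseteq> N" "\<And>x. x \<in> {c, b} \<Longrightarrow> f x = g x"
    using inj_on_extension[OF VN, of "{c, b}" g] b e0 by blast
  then show thesis using that[of f] s b by (simp add: g_def)
next
  case False
  obtain a b where ab: "e0 = {a, b}" "b \<noteq> a" using e0(2) by (auto simp: card_2_iff)
  have "card {a, b, c} = 3" using ab False by auto
  then have N3: "3 \<le> card N"
    using VN c ab e0 card_mono[OF VN(1), of "{a, b, c}"] by auto
  \<comment> \<open>If \<open>p \<in> S\<close>, an end of \<open>e0\<close> occupies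
    \<open>p\<close> and keeps \<open>c\<close> away from it. Otherwise
    \<open>S \<noteq> N - {p}\<close> supplies a vertex outside \<open>S\<close> other than
    \<open>p\<close>, which can serve as the image of \<open>c\<close>.\<close>
  have "\<exists>u v w. u \<in> S \<and> v \<in> S \<and> u \<noteq> v \<and> w \<in> N \<and> w \<noteq> u \<and> w \<noteq> v \<and> w \<noteq> p"
  proof (cases "p \<in> S")
    case True
    obtain v where v: "v \<in> S" "v \<noteq> p" using exists_other_element[OF S(2)] by blast
    have "\<not> N \<subseteq> {p, v}" using N3 card_mono[of "{p, v}" N] v by auto
    then show ?thesis using True v by blast
  next
    case False
    then obtain w where "w \<in> N" "w \<noteq> p" "w \<notin> S" using S by blast
    moreover obtain u v where "u \<in> S" "v \<in> S" "u \<noteq> v" using S(2) by (rule two_elements)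
    ultimately show ?thesis by metis
  qed
  then obtain u v w where w: "u \<in> S" "v \<in> S" "u \<noteq> v" "w \<in> N" "w \<noteq> u" "w \<noteq> v" "w \<noteq> p" by blast
  define g where "g = (\<lambda>x. if x = a then u else if x = b then v else w)"
  have "inj_on g {a, b, c}" "g ` {a, b, c} \<subseteq> N" using w S(1) ab False by (auto simp: g_def)
  moreover have "{a, b, c} \<subseteq> V" using ab c e0 by auto
  ultimately obtain f where "inj_on f V" "f ` V \<subseteq> N" "\<And>x. x \<in> {a, b, c} \<Longrightarrow> f x = g x"
    using inj_on_extension[OF VN] by metis
  then show thesis using that[of f] w ab False by (auto simp: g_def)
qed

text \<open>If some \<open>e0\<close> can be removed without leaving a common vertex, every
  embedding with \<open>e0\<close> inside \<open>S\<close> works, as no singleton can meet all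
  remaining edges. By \<open>exists_star_edge_deletion\<close> this fails only for three edges, and
  then \<open>V'\<close> has at most one member.\<close>

lemma exists_placement_singletons:
  assumes VN: "finite V" "finite N" "card V \<le> card N"
    and E: "\<And>e. e \<in> E \<Longrightarrow> e \<subseteq> V \<and> card e = 2" and "3 \<le> card E"
    and nstar: "4 \<le> card E \<Longrightarrow> \<not> (\<exists>c. \<forall>e\<in>E. c \<in> e)"
    and V': "\<And>X. X \<in> V' \<Longrightarrow> X \<subseteq> N \<and> card X = 1" "card V' \<le> card E - 2"
    and S: "S \<subseteq> N" "2 \<le> card S" "\<And>X. X \<in> V' \<Longrightarrow> S \<noteq> N - X"
  shows "\<exists>f e0. inj_on f V \<and> f ` V \<subseteq> N \<and> e0 \<in> E \<and> f ` e0 \<subseteq> S \<and>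
           (\<forall>X\<in>V'. \<exists>e\<in>E - {e0}. f ` e \<inter> X = {})"
proof -
  have finE: "finite E" using assms(5) by (auto intro: card_ge_0_finite)
  show ?thesis
  proof (cases "\<exists>e0\<in>E. \<forall>c. \<exists>e\<in>E - {e0}. c \<notin> e")
    case True
    then obtain e0 where e0: "e0 \<in> E" "\<forall>c. \<exists>e\<in>E - {e0}. c \<notin> e" by blast
    obtain f where f: "inj_on f V" "f ` V \<subseteq> N" "f ` e0 \<subseteq> S"
      using exists_embedding_edge[OF VN _ _ S(1,2), of e0] E[OF e0(1)] by blast
    have "\<exists>e\<in>E - {e0}. f ` e \<inter> X = {}" if "X \<in> V'" for X
    proof (rule ccontr)
      assume cov: "\<not> ?thesis"
      have X: "card X = 1" "finite X" using V'(1)[OF that] by (auto intro: card_ge_0_finite)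
      have cov': "\<forall>e\<in>E - {e0}. e \<subseteq> V" "\<forall>e\<in>E - {e0}. f ` e \<inter> X \<noteq> {}" using cov E by blast+
      obtain Y where Y: "Y \<subseteq> V" "card Y \<le> card X" "\<forall>e\<in>E - {e0}. e \<inter> Y \<noteq> {}"
        using cover_pullback[OF f(1) cov'(1) X(2) cov'(2)] by blast
      have "finite Y" using Y(1) VN(1) finite_subset by blast
      then have "\<forall>x\<in>Y. \<forall>y\<in>Y. x = y" using Y(2) X(1) by (simp add: card_le_Suc0_iff_eq)
      then obtain c where c: "Y \<subseteq> {c}" by (metis singletonI subsetI)
      from e0(2) obtain e where "e \<in> E - {e0}" "c \<notin> e" by blast
      then show False using Y(3) c by blast
    qed
    then show ?thesis using f e0(1) by blast
  next
    case False
    then have "\<not> 4 \<le> card E" using exists_star_edge_deletion[of E] E nstar by metis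
    then have E3: "card E = 3" using assms(5) by simp
    show ?thesis
    proof (cases "V' = {}")
      case True
      obtain e0 where e0: "e0 \<in> E" using E3 by fastforce
      then obtain f where "inj_on f V" "f ` V \<subseteq> N" "f ` e0 \<subseteq> S"
        using exists_embedding_edge[OF VN _ _ S(1,2), of e0] E[OF e0] by blast
      then show ?thesis using e0 True by blast
    next
      case nonempty: False
      have "V' \<subseteq> Pow N" using V'(1) by blast
      then have "finite V'" using VN(2) finite_subset by blast
      then have "card V' = 1" using V'(2) E3 nonempty by (simp add: card_gt_0_iff le_antisym Suc_leI)
      then obtain X where X: "V' = {X}" by (auto simp: card_1_singleton_iff)
      then obtain p where p: "V' = {{p}}" using V'(1) by (auto simp: card_1_singleton_iff)
      obtain e0 where e0: "e0 \<in> E" using E3 by fastforce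
      then obtain c where c: "\<forall>e\<in>E - {e0}. c \<in> e" using False by blast
      have "2 \<le> card (E - {e0})" using e0 E3 finE by simp
      then obtain h k where hk: "h \<in> E - {e0}" "k \<in> E - {e0}" "h \<noteq> k" by (rule two_elements)
      then have "c \<in> V" using c E by blast
      then obtain f where f: "inj_on f V" "f ` V \<subseteq> N" "f ` e0 \<subseteq> S" "f c \<noteq> p"
        using exists_embedding_avoiding_point[OF VN _ _ _ S(1,2), of e0 c p] E[OF e0] S(3)[of "{p}"] p by blast
      \<comment> \<open>If \<open>{p}\<close> met both remaining edges, they would share the
        preimage of \<open>p\<close> besides \<open>c\<close>, and two edges with two common
        vertices coincide.\<close>
      have "\<exists>e\<in>E - {e0}. f ` e \<inter> {p} = {}"
      proof (rule ccontr)
        assume cov: "\<not> ?thesis"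
        then obtain d where d: "d \<in> h" "f d = p" using hk(1) by blast
        obtain d' where d': "d' \<in> k" "f d' = p" using cov hk(2) by blast
        have "d = d'" using d d' f(1) E hk by (metis DiffD1 inj_onD subsetD)
        moreover have "d \<noteq> c" using f(4) d by auto
        moreover have "card h = 2" "card k = 2" "c \<in> h" "c \<in> k" using c hk E by auto
        ultimately show False using doubleton_eqI[of h d c] doubleton_eqI[of k d c] d(1) d'(1) hk(3) by simp
      qed
      then show ?thesis using f e0 p by blast
    qed
  qed
qed

text \<open>If some \<open>e0\<close> can be removed so that no two vertices cover the rest, every
  embedding with \<open>e0\<close> inside \<open>S\<close> works. Otherwise the covers belonging to
  different deletions coincide, so one pair \<open>{i, j}\<close> covers all of \<open>E\<close>.
  The embedding is then chosen to send this pair to a pair outside \<open>E'\<close>.\<close>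

lemma exists_placement_pairs:
  assumes VN: "finite V" "finite N" "card V \<le> card N"
    and E: "\<And>e. e \<in> E \<Longrightarrow> e \<subseteq> V \<and> card e = 2" and cE: "card E = card N + card E' + 2"
    and E': "\<And>X. X \<in> E' \<Longrightarrow> X \<subseteq> N \<and> card X = 2" "E' \<noteq> {}"
    and V': "\<And>X. X \<in> V' \<Longrightarrow> X \<subseteq> N \<and> card X = 1"
    and S: "S \<subseteq> N" "2 \<le> card S"
  shows "\<exists>f e0. inj_on f V \<and> f ` V \<subseteq> N \<and> e0 \<in> E \<and> f ` e0 \<subseteq> S \<and>
           (\<forall>X\<in>V' \<union> E'. \<exists>e\<in>E - {e0}. f ` e \<inter> X = {})"
proof -
  have finE: "finite E" using cE by (auto intro: card_ge_0_finite)
  have "E' \<subseteq> Pow N" using E'(1) by blast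
  then have finE': "finite E'" using VN(2) finite_subset by blast
  then have E'1: "1 \<le> card E'" using E'(2) by (simp add: Suc_leI card_gt_0_iff)
  have small: "card X \<le> 2" "X \<subseteq> N" if "X \<in> V' \<union> E'" for X using that V' E'(1) by fastforce+
  show ?thesis
  proof (cases "\<exists>e0\<in>E. \<forall>P. P \<subseteq> V \<and> card P \<le> 2 \<longrightarrow> (\<exists>e\<in>E - {e0}. e \<inter> P = {})")
    case True
    then obtain e0 where e0: "e0 \<in> E"
      and nc: "\<forall>P. P \<subseteq> V \<and> card P \<le> 2 \<longrightarrow> (\<exists>e\<in>E - {e0}. e \<inter> P = {})" by (rule bexE)
    obtain f where f: "inj_on f V" "f ` V \<subseteq> N" "f ` e0 \<subseteq> S"
      using exists_embedding_edge[OF VN _ _ S(1,2), of e0] E[OF e0] by blast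
    have "\<exists>e\<in>E - {e0}. f ` e \<inter> X = {}" if "X \<in> V' \<union> E'" for X
    proof (rule ccontr)
      assume cov: "\<not> ?thesis"
      have X: "finite X" using small[OF that] VN(2) finite_subset by blast
      have cov': "\<forall>e\<in>E - {e0}. e \<subseteq> V" "\<forall>e\<in>E - {e0}. f ` e \<inter> X \<noteq> {}" using cov E by blast+
      obtain Y where Y: "Y \<subseteq> V" "card Y \<le> card X" "\<forall>e\<in>E - {e0}. e \<inter> Y \<noteq> {}"
        using cover_pullback[OF f(1) cov'(1) X cov'(2)] by blast
      then have "card Y \<le> 2" using small(1)[OF that] by simp
      then show False using nc Y(1,3) by metis
    qed
    then show ?thesis using f e0(1) by blast
  next
    case False
    have ex: "\<exists>P. P \<subseteq> V \<and> card P \<le> 2 \<and> (\<forall>e\<in>E - {e0}. e \<inter> P \<noteq> {})" if "e0 \<in> E" for e0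
      using False that by simp
    obtain h where h: "h \<in> E" using cE by fastforce
    obtain P where P: "P \<subseteq> V" "card P \<le> 2" "\<forall>e\<in>E - {h}. e \<inter> P \<noteq> {}" using ex[OF h] by blast
    have ch: "card (E - {h}) = card E - 1" using h finE by simp
    have "E - {h} \<noteq> {}"
    proof
      assume "E - {h} = {}"
      then have "card E - 1 = 0" using ch by (metis card.empty)
      then show False using cE by simp
    qed
    then obtain k where k: "k \<in> E - {h}" by blast
    then have kE: "k \<in> E" by blast
    obtain Q where Q: "Q \<subseteq> V" "card Q \<le> 2" "\<forall>e\<in>E - {k}. e \<inter> Q \<noteq> {}" using ex[OF kE] by blast
    have "card (E - {h} - {k}) = card E - 2" using ch k finE by simp
    \<comment> \<open>Even two deletions leave \<open>card N + card E'\<close> edges, more than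
      \<open>card V\<close> since \<open>E'\<close> is nonempty. Hence the two covers
      \<open>P\<close> and \<open>Q\<close> agree.\<close>
    then have "card V < card (E - {h} - {k})" using cE VN(3) E'1 by simp
    then have PQ: "P = Q \<and> card P = 2"
      using P Q E by (intro cover_unique[OF VN(1), of "E - {h} - {k}"]) auto
    have covP: "e \<inter> P \<noteq> {}" if "e \<in> E" for e
    proof (cases "e = h")
      case True
      then show ?thesis using PQ Q(3) h k by blast
    next
      case False
      then show ?thesis using P(3) that by blast
    qed
    from PQ obtain i j where ij: "P = {i, j}" "i \<noteq> j" by (auto simp: card_2_iff)
    have star: "card {e \<in> E. c \<in> e} \<le> card N - 1" if "c \<in> V" for c
    proof -
      have "card {e \<in> E. c \<in> e} \<le> card (V - {c})" using E by (intro card_star_le[OF VN(1)]) auto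
      then show ?thesis using that VN by simp
    qed
    \<comment> \<open>An edge avoiding \<open>j\<close> consists of \<open>i\<close> and a further
      vertex \<open>a\<close>. Placing it in \<open>S\<close> fixes the images of \<open>i\<close>
      and \<open>a\<close> but leaves that of \<open>j\<close> free.\<close>
    have "\<exists>e\<in>E. j \<notin> e"
    proof (rule ccontr)
      assume "\<not> ?thesis"
      then have "{e \<in> E. j \<in> e} = E" by blast
      then show False using star[of j] P(1) ij(1) cE by simp
    qed
    then obtain e0 where e0: "e0 \<in> E" "j \<notin> e0" by blast
    then have "i \<in> e0" using covP ij by blast
    then obtain a where a: "e0 = {i, a}" "a \<noteq> i" using E[OF e0(1)] by (auto simp: card_2_iff)
    have aj: "a \<noteq> j" using a e0(2) by auto
    have "E = {e \<in> E. i \<in> e} \<union> {e \<in> E. j \<in> e}" using covP ij by blast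
    then have "card E \<le> card {e \<in> E. i \<in> e} + card {e \<in> E. j \<in> e}"
      using card_Un_le[of "{e \<in> E. i \<in> e}" "{e \<in> E. j \<in> e}"] by simp
    also have "\<dots> \<le> (card N - 1) + (card N - 1)" using star P(1) ij by (intro add_mono) auto
    finally have E'n: "card E' + 4 \<le> card N" using cE E'1 by linarith
    obtain u v where uv: "u \<in> S" "v \<in> S" "u \<noteq> v" using S(2) by (rule two_elements)
    \<comment> \<open>There are \<open>card N - 2\<close> candidates for \<open>w\<close>, whereas
      the two stars at \<open>i\<close> and \<open>j\<close> contain all edges and so force
      \<open>card E' \<le> card N - 4\<close>.\<close>
    have "\<exists>w\<in>N - {u, v}. {u, w} \<notin> E'"
    proof (rule ccontr)
      assume "\<not> ?thesis"
      then have "(\<lambda>w. {u, w}) ` (N - {u, v}) \<subseteq> E'" by blast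
      moreover have "inj_on (\<lambda>w. {u, w}) (N - {u, v})" by (auto simp: inj_on_def doubleton_eq_iff)
      ultimately have "card (N - {u, v}) \<le> card E'" using finE' card_inj_on_le by blast
      moreover have "card (N - {u, v}) = card N - 2"
        using uv S(1) VN(2) by (subst card_Diff_subset) auto
      ultimately show False using E'n by linarith
    qed
    then obtain w where w: "w \<in> N" "w \<noteq> u" "w \<noteq> v" "{u, w} \<notin> E'" by blast
    define g where "g = (\<lambda>x. if x = i then u else if x = a then v else w)"
    have "inj_on g {i, a, j}" "g ` {i, a, j} \<subseteq> N" using w S(1) uv ij a aj by (auto simp: g_def)
    moreover have "{i, a, j} \<subseteq> V" using P(1) ij a E[OF e0(1)] by auto
    ultimately obtain f where f: "inj_on f V" "f ` V \<subseteq> N" "\<And>x. x \<in> {i, a, j} \<Longrightarrow> f x = g x"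
      using inj_on_extension[OF VN] by metis
    have fv: "f i = u" "f a = v" "f j = w" using f(3) ij a aj by (auto simp: g_def)
    have "\<exists>e\<in>E - {e0}. f ` e \<inter> X = {}" if X: "X \<in> V' \<union> E'" for X
    proof (rule ccontr)
      assume cov: "\<not> ?thesis"
      let ?A = "(`) f ` (E - {e0})"
      have "inj_on ((`) f) (E - {e0})"
        using f(1) E by (intro inj_on_subset[OF inj_on_image_Pow]) auto
      then have cA: "card ?A = card E - 1" using e0 finE by (simp add: card_image)
      \<comment> \<open>The embedded graph without \<open>e0\<close> still has more than
        \<open>card N\<close> edges, so \<open>{u, w}\<close>, the image of \<open>{i, j}\<close>,
        is its only cover of size at most two. It is not in \<open>E'\<close>, and members of
        \<open>V'\<close> are too small.\<close>
      have "X = {u, w} \<and> card X = 2"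
      proof (rule cover_unique[OF VN(2), of ?A])
        show "e \<subseteq> N \<and> card e = 2" if "e \<in> ?A" for e
          using that E f(1,2) by (auto simp: card_image inj_on_subset)
        show "e \<inter> X \<noteq> {} \<and> e \<inter> {u, w} \<noteq> {}" if "e \<in> ?A" for e
        proof -
          from that obtain h where h: "h \<in> E - {e0}" "e = f ` h" by blast
          then have "h \<inter> {i, j} \<noteq> {}" using covP ij by blast
          then have "f ` h \<inter> {u, w} \<noteq> {}" using fv by blast
          then show ?thesis using cov h by blast
        qed
        show "card N < card ?A" using cA cE by simp
        show "card {u, w} \<le> 2" using w by simp
      qed (use small[OF X] w uv S(1) in auto)
      moreover have "X \<notin> E'" using calculation w(4) by simp
      ultimately show False using X V' by fastforce
    qed
    then show ?thesis using f(1,2) e0(1) a fv uv by (intro exI[of _ f] exI[of _ e0]) auto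
  qed
qed


subsection \<open>Saturation of the two constructions\<close>

lemma card_edges_le:
  assumes "finite V" "card V \<le> card N" "finite N" "\<And>e. e \<in> E \<Longrightarrow> e \<subseteq> V \<and> card e = 2"
  shows "card E \<le> card N choose 2"
proof -
  obtain f where f: "inj_on f V" "f ` V \<subseteq> N" using card_le_inj[OF assms(1,3,2)] by blast
  have "card E \<le> card {T. T \<subseteq> N \<and> card T = 2}"
  proof (rule card_inj_on_le)
    show "inj_on ((`) f) E"
      using f(1) assms(4) by (intro inj_on_subset[OF inj_on_image_Pow]) auto
    show "(`) f ` E \<subseteq> {T. T \<subseteq> N \<and> card T = 2}"
      using f assms(4) by (auto simp: card_image inj_on_subset)
    show "finite {T. T \<subseteq> N \<and> card T = 2}" using assms(3) by simp
  qed
  then show ?thesis using assms(3) by (simp add: n_subsets)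
qed

lemma contains_Berge_card_le:
  assumes "contains_Berge V E HV HE" "finite HE" shows "card E \<le> card HE"
proof -
  obtain \<phi> where "inj_on \<phi> E" "\<phi> ` E \<subseteq> HE"
    using assms(1) unfolding contains_Berge_def by (elim exE conjE)
  then show ?thesis using assms(2) by (rule card_inj_on_le)
qed

text \<open>A copy is impossible for lack of hyperedges, so the work lies in adding
  \<open>S\<close>: a placement lemma provides an embedding whose remaining edges no complement
  meets entirely, and Hall's theorem spreads these edges over all old hyperedges.\<close>

lemma Hnm_saturated:
  fixes V :: "'a set" and E :: "'a set set"
  assumes G: "simple_graph V E" and Vn: "card V \<le> n" and "2 \<le> card E"
    and nstar: "4 \<le> card E \<Longrightarrow> \<not> (\<exists>c. \<forall>e\<in>E. c \<in> e)"
    and V': "\<And>X. X \<in> V' \<Longrightarrow> X \<subseteq> {1..n} \<and> card X = 1" "card V' = min (card E - 2) n"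
    and E': "\<And>X. X \<in> E' \<Longrightarrow> X \<subseteq> {1..n} \<and> card X = 2" "card V' + card E' + 2 = card E"
  shows "Berge_saturated n V E (Hnm n V' E') \<and> card (Hnm n V' E') = card E - 1"
proof -
  define N where "N = {1..n}"
  have N: "finite N" "card N = n" by (simp_all add: N_def)
  note V'N = V'(1)[folded N_def] and E'N = E'(1)[folded N_def]
  have V: "finite V" "card V \<le> card N" and E: "\<And>e. e \<in> E \<Longrightarrow> e \<subseteq> V \<and> card e = 2"
    using G Vn N by (auto simp: simple_graph_def)
  have fin: "finite V'" "finite E'" "finite E"
    using V'N E'N E V N by (meson Pow_iff finite_Pow_iff finite_subset subsetI)+
  let ?X = "insert {} (V' \<union> E')"
  have X: "Y \<subseteq> N \<and> card Y \<le> 2" if "Y \<in> ?X" for Y using that V'N E'N by fastforce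
  have "V' \<inter> E' = {}" "{} \<notin> V' \<union> E'" using V'N E'N by fastforce+
  then have cX: "card ?X = card E - 1" using fin E'(2) by (simp add: card_Un_disjoint)
  have inj: "inj_on (\<lambda>Y. N - Y) (Pow N)" by (auto simp: inj_on_def)
  have Hnm: "Hnm n V' E' = (\<lambda>Y. N - Y) ` ?X" by (simp add: Hnm_def N_def)
  have "inj_on (\<lambda>Y. N - Y) ?X" using X by (intro inj_on_subset[OF inj]) auto
  then have cH: "card (Hnm n V' E') = card E - 1" using cX by (simp only: Hnm card_image)
  have nE: "card E \<le> n choose 2" using card_edges_le[OF V N(1) E] N(2) by simp
  have "is_hypergraph n (Hnm n V' E')"
  proof -
    have two: "2 \<le> card (N - Y)" if Y: "Y \<in> ?X" for Y
    proof -
      \<comment> \<open>For smaller \<open>n\<close> there is no room for the edges, since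
        \<open>card E \<le> n choose 2\<close>: two edges need \<open>n \<ge> 3\<close>, and a pair
        complement occurs only if \<open>card E \<ge> n + 3\<close>, which needs
        \<open>n \<ge> 4\<close>.\<close>
      have "card Y + 2 \<le> n"
      proof (rule ccontr)
        assume small: "\<not> ?thesis"
        consider "Y = {}" | "Y \<in> V'" | "Y \<in> E'" using Y by blast
        then show False
        proof cases
          case 1
          then have "n < 2" using small by simp
          then have "n choose 2 = 0" by simp
          then show False using nE assms(3) by linarith
        next
          case 2
          then have "card Y = 1" using V'(1) by blast
          then have "n < 3" using small by simp
          then have "n choose 2 \<le> 1" by (auto simp: less_Suc_eq numeral_eq_Suc)
          then show False using nE assms(3) by linarith
        next
          case 3
          then have "card Y = 2" using E'(1) by blast
          then have "n < 4" using small by simp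
          then have "n choose 2 \<le> n" by (auto simp: less_Suc_eq numeral_eq_Suc)
          moreover have "card E' \<noteq> 0" using 3 fin by auto
          ultimately show False using nE V'(2) E'(2) by linarith
        qed
      qed
      then show ?thesis using X[OF Y] N card_Diff_subset[of Y N] finite_subset[of Y N] by simp
    qed
    show ?thesis unfolding is_hypergraph_def Hnm N_def[symmetric]
    proof
      fix h assume "h \<in> (\<lambda>Y. N - Y) ` ?X"
      then obtain Y where "Y \<in> ?X" "h = N - Y" by (rule imageE)
      then show "h \<subseteq> N \<and> 2 \<le> card h" using two[of Y] by blast
    qed
  qed
  moreover have "\<not> contains_Berge V E {1..n} (Hnm n V' E')"
  proof
    have "finite (Hnm n V' E')" using fin Hnm by simp
    moreover assume "contains_Berge V E {1..n} (Hnm n V' E')"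
    ultimately have "card E \<le> card (Hnm n V' E')" by (rule contains_Berge_card_le[rotated])
    then show False using cH assms(3) by simp
  qed
  moreover have "contains_Berge V E {1..n} (insert S (Hnm n V' E'))"
    if S: "S \<subseteq> {1..n}" "2 \<le> card S" "S \<notin> Hnm n V' E'" for S
  proof -
    have SN: "S \<subseteq> N" using S(1) by (simp add: N_def)
    have SX: "S \<noteq> N - Y" if "Y \<in> V'" for Y using that S(3) Hnm by blast
    have "\<exists>f e0. inj_on f V \<and> f ` V \<subseteq> N \<and> e0 \<in> E \<and> f ` e0 \<subseteq> S \<and>
        (\<forall>Y\<in>V' \<union> E'. \<exists>e\<in>E - {e0}. f ` e \<inter> Y = {})"
    proof (cases "E' = {}")
      case True
      then have cV': "card V' = card E - 2" using E'(2) by simp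
      show ?thesis
      proof (cases "card E = 2")
        case two: True
        then have "V' = {}" using cV' fin by simp
        moreover obtain e0 where e0: "e0 \<in> E" using two by fastforce
        moreover obtain f where "inj_on f V" "f ` V \<subseteq> N" "f ` e0 \<subseteq> S"
          using exists_embedding_edge[OF V(1) N(1) V(2) _ _ SN S(2), of e0] E[OF e0] by blast
        ultimately show ?thesis using True by blast
      next
        case False
        then have "3 \<le> card E" using assms(3) by simp
        then show ?thesis
          using exists_placement_singletons[OF V(1) N(1) V(2) E _ nstar V'N _ SN S(2) SX] cV' True by simp
      qed
    next
      case False
      \<comment> \<open>Pairs occur only after all \<open>n\<close> singletons are used up, which
        gives the exact edge count needed for the covering arguments.\<close>
      then have "card E' \<noteq> 0" using fin by simp
      then have "card E = card N + card E' + 2" using E'(2) V'(2) N(2) by simp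
      then show ?thesis
        using exists_placement_pairs[OF V(1) N(1) V(2) E _ E'N False V'N SN S(2)] by simp
    qed
    then obtain f e0 where f: "inj_on f V" "f ` V \<subseteq> N" and e0: "e0 \<in> E" "f ` e0 \<subseteq> S"
      and nocov: "\<forall>Y\<in>V' \<union> E'. \<exists>e\<in>E - {e0}. f ` e \<inter> Y = {}" by (elim exE conjE)
    let ?F = "(`) f ` (E - {e0})"
    have injf: "inj_on ((`) f) E"
      using f(1) E by (intro inj_on_subset[OF inj_on_image_Pow]) auto
    then have "inj_on ((`) f) (E - {e0})" by (rule inj_on_subset) auto
    then have cF: "card ?F = card E - 1" using e0 fin by (simp add: card_image)
    have "\<exists>\<phi>. inj_on \<phi> ?F \<and> (\<forall>e\<in>?F. \<phi> e \<in> ?X \<and> e \<inter> \<phi> e = {})"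
    proof (rule exists_avoiding_assignment[OF N(1)])
      show "e \<subseteq> N \<and> card e = 2" if "e \<in> ?F" for e
        using that E f by (auto simp: card_image inj_on_subset)
      show "?F \<noteq> {}" using cF assms(3) by (metis card.empty diff_is_0_eq not_less_eq_eq numeral_2_eq_2 One_nat_def)
      show "\<exists>e\<in>?F. e \<inter> Y = {}" if "Y \<in> V' \<union> E'" for Y using nocov that by simp
    qed (use V'N V'(2) E'N E'(2) cF N(2) in auto)
    then obtain \<phi> where \<phi>: "inj_on \<phi> ?F" "\<forall>e\<in>?F. \<phi> e \<in> ?X \<and> e \<inter> \<phi> e = {}" by blast
    have \<phi>N: "\<phi> T \<subseteq> N" if "T \<in> ?F" for T
      using bspec[OF \<phi>(2) that] X[of "\<phi> T"] by simp
    define \<Phi> where "\<Phi> e = (if e = e0 then S else N - \<phi> (f ` e))" for e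
    have \<Phi>: "\<Phi> e \<in> Hnm n V' E'" "f ` e \<subseteq> \<Phi> e" if "e \<in> E - {e0}" for e
    proof -
      have "f ` e \<in> ?F" using that by blast
      then have "\<phi> (f ` e) \<in> ?X" "f ` e \<inter> \<phi> (f ` e) = {}" using \<phi>(2) by blast+
      moreover have "f ` e \<subseteq> N" using that E f(2) by blast
      ultimately show "\<Phi> e \<in> Hnm n V' E'" "f ` e \<subseteq> \<Phi> e" using that unfolding \<Phi>_def Hnm by auto
    qed
    have "inj_on \<Phi> (insert e0 (E - {e0}))"
    proof (subst inj_on_insert, intro conjI)
      show "inj_on \<Phi> (E - {e0})"
      proof (rule inj_onI)
        fix e h assume e: "e \<in> E - {e0}" and h: "h \<in> E - {e0}" and "\<Phi> e = \<Phi> h"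
        then have "N - \<phi> (f ` e) = N - \<phi> (f ` h)" by (simp add: \<Phi>_def)
        moreover have F: "f ` e \<in> ?F" "f ` h \<in> ?F" using e h by blast+
        moreover have "\<phi> (f ` e) \<in> Pow N" "\<phi> (f ` h) \<in> Pow N" using \<phi>N F by auto
        ultimately have "\<phi> (f ` e) = \<phi> (f ` h)" using inj by (meson inj_onD)
        then have "f ` e = f ` h" using \<phi>(1) F by (meson inj_onD)
        then show "e = h" using injf e h by (meson DiffD1 inj_onD)
      qed
      show "\<Phi> e0 \<notin> \<Phi> ` (E - {e0} - {e0})"
      proof
        assume "\<Phi> e0 \<in> \<Phi> ` (E - {e0} - {e0})"
        then obtain e where "e \<in> E - {e0}" "\<Phi> e0 = \<Phi> e" by blast
        then show False using \<Phi>(1)[of e] S(3) by (simp add: \<Phi>_def[of e0])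
      qed
    qed
    moreover have "insert e0 (E - {e0}) = E" using e0 by blast
    ultimately have "inj_on \<Phi> E" by simp
    moreover have "\<Phi> ` E \<subseteq> insert S (Hnm n V' E')"
    proof
      fix h assume "h \<in> \<Phi> ` E"
      then obtain e where "e \<in> E" "h = \<Phi> e" by blast
      then show "h \<in> insert S (Hnm n V' E')" using \<Phi>(1)[of e] by (cases "e = e0") (auto simp: \<Phi>_def)
    qed
    moreover have "\<forall>e\<in>E. f ` e \<subseteq> \<Phi> e"
    proof
      fix e assume "e \<in> E"
      then show "f ` e \<subseteq> \<Phi> e" using \<Phi>(2)[of e] e0(2) by (cases "e = e0") (auto simp: \<Phi>_def)
    qed
    ultimately show ?thesis using f unfolding contains_Berge_def N_def
      by (intro exI[of _ f] exI[of _ \<Phi>] conjI)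
  qed
  ultimately show ?thesis using cH unfolding Berge_saturated_def by blast
qed

section \<open>Stars and the hypergraph \<open>H_t\<close>\<close>

text \<open>Distinct representatives of the sets \<open>h - {v}\<close> serve as leaves around the
  centre \<open>v\<close>.\<close>

lemma star_contains_Berge:
  assumes G: "simple_graph V E" "no_isolated V E" and c: "\<forall>e\<in>E. c \<in> e"
    and F: "finite F" "card F = card E" "F \<subseteq> HE" "\<And>h. h \<in> F \<Longrightarrow> v \<in> h \<and> h \<subseteq> N" and v: "v \<in> N"
    and fin: "finite E" "finite N"
    and hall: "\<And>J. J \<subseteq> F \<Longrightarrow> card J \<le> card (\<Union> J - {v})"
  shows "contains_Berge V E N HE"
proof -
  have "\<exists>g. inj_on g F \<and> (\<forall>h\<in>F. g h \<in> h - {v})"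
  proof (rule hall_marriage[OF F(1)])
    show "finite (h - {v})" if "h \<in> F" for h using F(4)[OF that] fin finite_subset by blast
    show "card J \<le> card (\<Union>h\<in>J. h - {v})" if "J \<subseteq> F" for J
      using hall[OF that] by (simp add: UN_extend_simps)
  qed
  then obtain g where g: "inj_on g F" "\<forall>h\<in>F. g h \<in> h - {v}" by blast
  \<comment> \<open>Any bijection will do, as the edges of a star are interchangeable: each leaf
    goes to the representative of the hyperedge that its edge receives.\<close>
  obtain b where b: "bij_betw b E F" using F fin by (metis finite_same_card_bij)
  have leaf: "{c, x} \<in> E" if x: "x \<in> V" "x \<noteq> c" for x
  proof -
    obtain e where e: "e \<in> E" "x \<in> e" using x G(2) by (auto simp: no_isolated_def)
    then have "e = {c, x}" using G(1) c x by (intro doubleton_eqI) (auto simp: simple_graph_def)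
    then show ?thesis using e by simp
  qed
  have bF: "b e \<in> F" if "e \<in> E" for e using b that by (auto simp: bij_betw_def)
  define f where "f x = (if x = c then v else g (b {c, x}))" for x
  have fleaf: "f x \<in> b {c, x} - {v}" if "x \<in> V" "x \<noteq> c" for x
    using leaf[OF that] bF g(2) that by (auto simp: f_def)
  have "inj_on f V"
  proof (rule inj_onI)
    fix x y assume xy: "x \<in> V" "y \<in> V" "f x = f y"
    consider "x = c" | "y = c" | "x \<noteq> c" "y \<noteq> c" by blast
    then show "x = y"
    proof cases
      case 1
      then show ?thesis using xy fleaf[of y] by (auto simp: f_def split: if_splits)
    next
      case 2
      then show ?thesis using xy fleaf[of x] by (auto simp: f_def split: if_splits)
    next
      case 3
      then have "g (b {c, x}) = g (b {c, y})" using xy by (simp add: f_def)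
      moreover have E: "{c, x} \<in> E" "{c, y} \<in> E" using leaf xy 3 by auto
      ultimately have "b {c, x} = b {c, y}" using g(1) bF by (meson inj_onD)
      then have "{c, x} = {c, y}" using b E by (meson bij_betw_def inj_onD)
      then show ?thesis by (auto simp: doubleton_eq_iff)
    qed
  qed
  moreover have "f ` V \<subseteq> N"
  proof
    fix y assume "y \<in> f ` V"
    then obtain x where x: "x \<in> V" "y = f x" by blast
    show "y \<in> N"
    proof (cases "x = c")
      case False
      then show ?thesis using fleaf[of x] leaf[of x] x bF F(4) by blast
    qed (use x v in \<open>simp add: f_def\<close>)
  qed
  moreover have "f ` e \<subseteq> b e" if e: "e \<in> E" for e
  proof -
    have "card e = 2" "c \<in> e" "e \<subseteq> V" using e G(1) c by (auto simp: simple_graph_def)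
    then obtain x where x: "e = {c, x}" "x \<noteq> c" "x \<in> V" by (auto simp: card_2_iff)
    then have "f x \<in> b e" using fleaf by blast
    moreover have "f c \<in> b e" using F(4)[OF bF[OF e]] by (simp add: f_def)
    ultimately show ?thesis using x by simp
  qed
  moreover have "b ` E \<subseteq> HE" "inj_on b E" using b F(3) by (auto simp: bij_betw_def)
  ultimately show ?thesis unfolding contains_Berge_def by blast
qed

lemma card_star_edges:
  assumes G: "simple_graph V E" "no_isolated V E" and c: "c \<in> V" "\<forall>e\<in>E. c \<in> e"
  shows "card V = card E + 1"
proof -
  have "finite V" using G(1) by (simp add: simple_graph_def)
  have "E = (\<lambda>x. {c, x}) ` (V - {c})"
  proof
    show "E \<subseteq> (\<lambda>x. {c, x}) ` (V - {c})"
    proof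
      fix e assume e: "e \<in> E"
      then have "card e = 2" "c \<in> e" "e \<subseteq> V" using G(1) c by (auto simp: simple_graph_def)
      then obtain x where "e = {c, x}" "x \<noteq> c" "x \<in> V" by (auto simp: card_2_iff)
      then show "e \<in> (\<lambda>x. {c, x}) ` (V - {c})" by blast
    qed
    show "(\<lambda>x. {c, x}) ` (V - {c}) \<subseteq> E"
    proof
      fix e assume "e \<in> (\<lambda>x. {c, x}) ` (V - {c})"
      then obtain x where x: "e = {c, x}" "x \<in> V" "x \<noteq> c" by blast
      then obtain h where h: "h \<in> E" "x \<in> h" using G(2) by (auto simp: no_isolated_def)
      then have "h = {c, x}" using G(1) c x by (intro doubleton_eqI) (auto simp: simple_graph_def)
      then show "e \<in> E" using x h by simp
    qed
  qed
  moreover have "inj_on (\<lambda>x. {c, x}) (V - {c})" by (auto simp: inj_on_def doubleton_eq_iff)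
  ultimately have "card E = card (V - {c})" by (metis card_image)
  then show ?thesis using c(1) \<open>finite V\<close> by (metis card_Suc_Diff1 Suc_eq_plus1)
qed

lemma card_Union_gt:
  assumes "finite (\<Union> J)" "h \<in> J" "k \<in> J" "h \<noteq> k" "m \<le> card h" "m \<le> card k"
  shows "m < card (\<Union> J)"
proof -
  have "h \<subset> \<Union> J \<or> k \<subset> \<Union> J" using assms(2-4) by blast
  then show ?thesis using assms(1,5,6) by (meson le_less_trans psubset_card_mono)
qed

text \<open>The union has to exceed \<open>card J\<close>. Among four sets, two miss at most one
  point of \<open>N\<close> each and together fill \<open>N\<close>; among three, one has at least
  four elements; two distinct sets of size at least two have a union of at least three.\<close>

lemma hall_condition_large_sets:
  assumes N: "finite N" "5 \<le> card N" and J: "\<And>h. h \<in> J \<Longrightarrow> h \<subseteq> N \<and> v \<in> h \<and> 2 \<le> card h"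
    and small: "card {h \<in> J. card h + 1 < card N} \<le> 2" and cJ: "card J + 1 \<le> card N"
  shows "card J \<le> card (\<Union> J - {v})"
proof (cases "J = {}")
  case False
  have finJ: "finite J" using J N(1) by (meson Pow_iff finite_Pow_iff finite_subset subsetI)
  have finU: "finite (\<Union> J)" using J N(1) by (meson Sup_least finite_subset)
  have "v \<in> \<Union> J" using J False by blast
  then have cU: "card (\<Union> J - {v}) = card (\<Union> J) - 1" using finU by simp
  have mono: "card h \<le> card (\<Union> J)" if "h \<in> J" for h using that finU by (intro card_mono) auto
  let ?L = "{h \<in> J. card N \<le> card h + 1}"
  have "J = ?L \<union> {h \<in> J. card h + 1 < card N}" by auto
  then have "card J \<le> card ?L + card {h \<in> J. card h + 1 < card N}" by (metis (no_types, lifting) card_Un_le)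
  then have L: "card J \<le> card ?L + 2" using small by linarith
  have "card J < card (\<Union> J)"
  proof (cases "4 \<le> card J")
    case True
    then have "2 \<le> card ?L" using L by linarith
    then obtain h k where "h \<in> ?L" "k \<in> ?L" "h \<noteq> k" by (rule two_elements)
    then have "card N - 1 < card (\<Union> J)" by (intro card_Union_gt[OF finU, of h k]) auto
    then show ?thesis using cJ by linarith
  next
    case lt4: False
    show ?thesis
    proof (cases "card J = 3")
      case True
      then have "card ?L \<noteq> 0" using L by linarith
      then have "?L \<noteq> {}" by (metis card.empty)
      then obtain h where "h \<in> ?L" by blast
      then show ?thesis using mono[of h] True N(2) by auto
    next
      case not3: False
      show ?thesis
      proof (cases "card J = 2")
        case True
        then obtain h k where "h \<in> J" "k \<in> J" "h \<noteq> k" by (auto simp: card_2_iff)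
        then show ?thesis using card_Union_gt[OF finU, of h k 2] J True by auto
      next
        case False
        then have "card J \<le> 1" using lt4 not3 by linarith
        moreover obtain h where "h \<in> J" using \<open>J \<noteq> {}\<close> by blast
        ultimately show ?thesis using mono[of h] J[of h] by linarith
      qed
    qed
  qed
  then show ?thesis using cU by linarith
qed simp

text \<open>A copy of the star would use all hyperedges, whose intersection is empty. After adding
  \<open>S\<close>, discarding one suitable old hyperedge leaves \<open>card E\<close> of them
  through a common vertex, and they are nearly all so large that Hall's condition holds.\<close>

lemma H_t_saturated:
  fixes V :: "'a set" and E :: "'a set set"
  assumes G: "simple_graph V E" "no_isolated V E" and Vn: "card V \<le> n" and E4: "4 \<le> card E"
    and c: "c \<in> V" "\<forall>e\<in>E. c \<in> e"
  shows "Berge_saturated n V E (H_t (card V) n) \<and> card (H_t (card V) n) = card E"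
proof -
  define N where "N = {1..n}"
  define k where "k = card E - 2"
  define K where "K = {1..k}"
  have N: "finite N" "card N = n" by (simp_all add: N_def)
  have cV: "card V = card E + 1" using card_star_edges[OF G c] .
  have k: "2 \<le> k" "k + 3 \<le> n" "card E = k + 2" using E4 Vn cV by (simp_all add: k_def)
  have K: "K \<subseteq> N" "card K = k" "finite K" using k by (auto simp: K_def N_def)
  have finE: "finite E" using E4 by (auto intro: card_ge_0_finite)
  let ?H = "H_t (card V) n"
  let ?D = "(\<lambda>i. N - {i}) ` K"
  \<comment> \<open>A star without isolated vertices has \<open>card E + 1\<close> vertices, so
    \<open>t - 3\<close> equals \<open>card E - 2\<close>. Together with \<open>N\<close> and
    \<open>K\<close> this makes \<open>card E\<close> hyperedges.\<close>
  have "card V - 3 = k" using cV k by simp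
  then have "?H = {N} \<union> ?D \<union> {K}"
    unfolding H_t_def N_def K_def by (simp only: Setcompr_eq_image)
  then have H: "?H = insert N (insert K ?D)" by (simp only: Un_insert_right Un_empty_right insert_is_Un[symmetric] insert_commute)
  have mem: "h = N \<or> h = K \<or> (\<exists>i\<in>K. h = N - {i})" if "h \<in> ?H" for h
    using that unfolding H by blast
  have cD: "card (N - {i}) = n - 1" if "i \<in> K" for i using that K N by auto
  have inj: "inj_on (\<lambda>i. N - {i}) K"
  proof (rule inj_onI)
    fix i j assume "i \<in> K" "j \<in> K" "N - {i} = N - {j}"
    then show "i = j" using K(1) by blast
  qed
  have KD: "K \<notin> ?D"
  proof
    assume "K \<in> ?D"
    then obtain i where "i \<in> K" "K = N - {i}" by blast
    then show False using cD[of i] K(2) k by simp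
  qed
  have ND: "N \<notin> insert K ?D"
  proof
    assume "N \<in> insert K ?D"
    then consider "N = K" | i where "i \<in> K" "N = N - {i}" by blast
    then show False
    proof cases
      case 1
      then show False using K(2) N(2) k by simp
    next
      case 2
      then show False using cD[of i] N(2) k by simp
    qed
  qed
  have finH: "finite ?H" using H K(3) by simp
  have "card ?D = k" using inj K(2) by (simp add: card_image)
  then have cH: "card ?H = card E" using H KD ND K(3) k(3) by simp
  have big: "h \<subseteq> N \<and> 2 \<le> card h" if "h \<in> ?H" for h
  proof -
    from mem[OF that] consider "h = N" | "h = K" | i where "i \<in> K" "h = N - {i}" by blast
    then show ?thesis
    proof cases
      case 3
      then show ?thesis using cD[of i] k by auto
    qed (use K N k in auto)
  qed
  have "\<not> contains_Berge V E {1..n} ?H"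
  proof
    assume "contains_Berge V E {1..n} ?H"
    then obtain f \<phi> where f: "inj_on \<phi> E" "\<phi> ` E \<subseteq> ?H" "\<forall>e\<in>E. f ` e \<subseteq> \<phi> e"
      unfolding contains_Berge_def by (elim exE conjE)
    have "\<phi> ` E = ?H" using f finH cH by (intro card_subset_eq) (simp_all add: card_image)
    have all: "f c \<in> h" if "h \<in> ?H" for h
    proof -
      from that obtain e where "e \<in> E" "h = \<phi> e" using \<open>\<phi> ` E = _\<close> by (metis imageE)
      then show ?thesis using f(3) c(2) by blast
    qed
    have "K \<in> ?H" unfolding H by blast
    then have "f c \<in> K" by (rule all)
    then have "N - {f c} \<in> ?H" unfolding H by blast
    then show False using all by blast
  qed
  moreover have "contains_Berge V E {1..n} (insert S ?H)"
    if S: "S \<subseteq> {1..n}" "2 \<le> card S" "S \<notin> ?H" for S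
  proof -
    have SN: "S \<subseteq> N" using S(1) by (simp add: N_def)
    \<comment> \<open>A vertex \<open>v\<close> outside \<open>K\<close> is missed only by
      \<open>K\<close> among the old hyperedges, and a vertex \<open>v\<close> in \<open>K\<close>
      only by \<open>N - {v}\<close>. Either way a single hyperedge has to be dropped.\<close>
    have "\<exists>v F. F \<subseteq> insert S ?H \<and> card F = card E \<and> (\<forall>h\<in>F. v \<in> h)"
    proof (cases "S \<inter> K = {}")
      case True
      have "S \<noteq> {}" using S(2) by auto
      then obtain v where v: "v \<in> S" by blast
      then have "v \<notin> K" "v \<in> N" using True SN by auto
      let ?F = "insert S ?H - {K}"
      have "card ?F = card E" using cH finH S(3) H by simp
      moreover have "v \<in> h" if "h \<in> ?F" for h
      proof -
        from that have "h = S \<or> h \<in> ?H" "h \<noteq> K" by auto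
        then consider "h = S" | "h = N" | i where "i \<in> K" "h = N - {i}" using mem[of h] by blast
        then show ?thesis using v \<open>v \<notin> K\<close> \<open>v \<in> N\<close> by cases auto
      qed
      ultimately show ?thesis by (intro exI[of _ v] exI[of _ ?F] conjI ballI Diff_subset)
    next
      case False
      then obtain v where v: "v \<in> S" "v \<in> K" by blast
      let ?F = "insert S ?H - {N - {v}}"
      have "N - {v} \<in> ?H" using H v(2) by blast
      then have "card ?F = card E" using cH finH S(3) by simp
      moreover have "v \<in> h" if h: "h \<in> ?F" for h
      proof -
        from h have hS: "h = S \<or> h \<in> ?H" and hv: "h \<noteq> N - {v}" by auto
        then consider "h = S" | "h = N" | "h = K" | i where "i \<in> K" "h = N - {i}" using mem[of h] by blast
        then show ?thesis
        proof cases
          case 4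
          then have "i \<noteq> v" using hv by blast
          then show ?thesis using 4 v K(1) by blast
        qed (use v K(1) in auto)
      qed
      ultimately show ?thesis by (intro exI[of _ v] exI[of _ ?F] conjI ballI Diff_subset)
    qed
    then obtain v F where F: "F \<subseteq> insert S ?H" "card F = card E" and vF: "\<forall>h\<in>F. v \<in> h" by blast
    have finF: "finite F" using F(1) finH by (metis finite_insert finite_subset)
    have FN: "h \<subseteq> N \<and> v \<in> h \<and> 2 \<le> card h" if "h \<in> F" for h
      using that F(1) vF big[of h] SN S(2) by auto
    have "F \<noteq> {}" using F(2) E4 by auto
    then have vN: "v \<in> N" using FN by blast
    show ?thesis unfolding N_def[symmetric]
    proof (rule star_contains_Berge[OF G c(2) finF F(2,1) _ vN finE N(1)])
      show "card J \<le> card (\<Union> J - {v})" if J: "J \<subseteq> F" for J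
      proof (rule hall_condition_large_sets[OF N(1)])
        show "5 \<le> card N" using N(2) k by simp
        show "h \<subseteq> N \<and> v \<in> h \<and> 2 \<le> card h" if "h \<in> J" for h using that J FN by blast
        \<comment> \<open>All other hyperedges have at least \<open>n - 1\<close> elements, which
          bounds the number of small ones by two.\<close>
        have "h = S \<or> h = K" if "h \<in> F" "card h + 1 < card N" for h
        proof -
          from that(1) F(1) have "h = S \<or> h \<in> ?H" by blast
          then consider "h = S" | "h = N" | "h = K" | i where "i \<in> K" "h = N - {i}" using mem[of h] by blast
          then show ?thesis
          proof cases
            case 4
            then show ?thesis using cD[of i] that(2) N(2) by simp
          qed (use that(2) in auto)
        qed
        then have "{h \<in> J. card h + 1 < card N} \<subseteq> {S, K}" using J by blast
        then have "card {h \<in> J. card h + 1 < card N} \<le> card {S, K}" by (intro card_mono) auto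
        also have "\<dots> \<le> 2" by (simp add: card_insert_if)
        finally show "card {h \<in> J. card h + 1 < card N} \<le> 2" .
        have "card J \<le> card F" using J finF by (rule card_mono[rotated])
        then show "card J + 1 \<le> card N" using F(2) N(2) k by simp
      qed
    qed (use FN in blast)
  qed
  moreover have "is_hypergraph n ?H" unfolding is_hypergraph_def using big by (simp add: N_def)
  ultimately show ?thesis using cH unfolding Berge_saturated_def by blast
qed

subsection \<open>Lower bounds\<close>

lemma hypergraph_finite:
  assumes "is_hypergraph n HE" shows "finite HE"
proof (rule finite_subset)
  show "HE \<subseteq> Pow {1..n}" using assms unfolding is_hypergraph_def by (meson PowI subsetI)
qed simp

text \<open>Saturation only speaks about missing hyperedges, so the lower bounds first need one.
  \<open>{1..n}\<close> has at least \<open>card E\<close> pairs, more than \<open>HE\<close> can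
  contain.\<close>

lemma exists_missing_pair:
  assumes "simple_graph V E" "card V \<le> n" "finite HE" "card HE < card E"
  obtains S where "S \<subseteq> {1..n}" "card S = 2" "S \<notin> HE"
proof -
  have "card E \<le> card {1..n} choose 2"
    using assms(1,2) by (intro card_edges_le[of V]) (auto simp: simple_graph_def)
  also have "\<dots> = card {S. S \<subseteq> {1..n} \<and> card S = 2}" by (rule n_subsets[symmetric]) simp
  finally have "\<not> {S. S \<subseteq> {1..n} \<and> card S = 2} \<subseteq> HE"
    using assms(3,4) by (meson card_mono le_less_trans not_less)
  then show thesis using that by blast
qed

lemma Berge_saturated_card_ge:
  assumes "simple_graph V E" "card V \<le> n" and sat: "Berge_saturated n V E HE"
  shows "card E - 1 \<le> card HE"
proof (rule ccontr)
  assume "\<not> ?thesis"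
  then have lt: "card HE + 1 < card E" by simp
  have fin: "finite HE" using sat hypergraph_finite unfolding Berge_saturated_def by blast
  have "card HE < card E" using lt by simp
  then obtain S where "S \<subseteq> {1..n}" "card S = 2" "S \<notin> HE"
    by (rule exists_missing_pair[OF assms(1,2) fin])
  then have "contains_Berge V E {1..n} (insert S HE)" using sat unfolding Berge_saturated_def by simp
  then have "card E \<le> card (insert S HE)" using fin by (intro contains_Berge_card_le) auto
  also have "\<dots> \<le> card HE + 1" using card_insert_le_m1[of "card HE + 1" HE S] by simp
  finally show False using lt by simp
qed

text \<open>A new hyperedge must meet the common intersection of the old ones, which forces that
  intersection to miss at most one vertex and leaves room for at most two hyperedges.\<close>
lemma star_saturated_card_ge:
  assumes G: "simple_graph V E" and Vn: "card V \<le> n" and E4: "4 \<le> card E" and c: "\<forall>e\<in>E. c \<in> e"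
    and sat: "Berge_saturated n V E HE"
  shows "card E \<le> card HE"
proof (rule ccontr)
  assume lt: "\<not> ?thesis"
  have hyp: "is_hypergraph n HE" using sat unfolding Berge_saturated_def by blast
  then have fin: "finite HE" by (rule hypergraph_finite)
  have cHE: "card HE + 1 = card E" using lt Berge_saturated_card_ge[OF G Vn sat] E4 by simp
  define K where "K = {v \<in> {1..n}. \<forall>h\<in>HE. v \<in> h}"
  have Kh: "K \<subseteq> h" if "h \<in> HE" for h using that by (auto simp: K_def)
  have meet: "S \<inter> K \<noteq> {}" if S: "S \<subseteq> {1..n}" "2 \<le> card S" "S \<notin> HE" for S
  proof -
    have "contains_Berge V E {1..n} (insert S HE)" using S sat unfolding Berge_saturated_def by blast
    then obtain f \<phi> where f: "inj_on \<phi> E" "\<phi> ` E \<subseteq> insert S HE" "\<forall>e\<in>E. f ` e \<subseteq> \<phi> e"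
      unfolding contains_Berge_def by (elim exE conjE)
    \<comment> \<open>The numbers agree, so the copy uses every hyperedge and its centre lies in
      \<open>S\<close> and in all of \<open>HE\<close>.\<close>
    have "\<phi> ` E = insert S HE"
      using f fin cHE S(3) by (intro card_subset_eq) (simp_all add: card_image)
    have "f c \<in> h" if "h \<in> insert S HE" for h
    proof -
      from that obtain e where "e \<in> E" "h = \<phi> e" using \<open>\<phi> ` E = _\<close> by (metis imageE)
      then show ?thesis using f(3) c by blast
    qed
    then have "f c \<in> S" "\<forall>h\<in>HE. f c \<in> h" by auto
    then show ?thesis using S(1) unfolding K_def by blast
  qed
  have "card HE < card E" using cHE by simp
  then obtain S0 where "S0 \<subseteq> {1..n}" "card S0 = 2" "S0 \<notin> HE"
    by (rule exists_missing_pair[OF G Vn fin])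
  then have Kne: "K \<noteq> {}" using meet[of S0] by auto
  \<comment> \<open>A pair disjoint from \<open>K\<close> cannot be a missing hyperedge by
    \<open>meet\<close>; nor can it be present, because every hyperedge contains the nonempty
    \<open>K\<close>.\<close>
  have one: "a = b" if ab: "a \<in> {1..n} - K" "b \<in> {1..n} - K" for a b
  proof (rule ccontr)
    assume "a \<noteq> b"
    then have "{a, b} \<in> HE" using meet[of "{a, b}"] ab by auto
    then have "K \<subseteq> {a, b}" by (rule Kh)
    then show False using ab Kne by blast
  qed
  \<comment> \<open>Each hyperedge lies between \<open>K\<close> and \<open>{1..n}\<close>, which
    differ in at most one vertex. Two hyperedges are too few, since \<open>card HE \<ge> 3\<close>
    for a star with at least four edges.\<close>
  have "HE \<subseteq> {{1..n}, K}"
  proof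
    fix h assume h: "h \<in> HE"
    then have "h \<subseteq> {1..n}" "K \<subseteq> h" using hyp Kh by (auto simp only: is_hypergraph_def)
    moreover have "h = {1..n}" if hK: "h \<noteq> K"
    proof -
      obtain a where a: "a \<in> h" "a \<notin> K" using hK \<open>K \<subseteq> h\<close> by blast
      then have "b \<in> h" if "b \<in> {1..n}" for b
        using one[of a b] that \<open>h \<subseteq> {1..n}\<close> \<open>K \<subseteq> h\<close> by blast
      then show ?thesis using \<open>h \<subseteq> {1..n}\<close> by blast
    qed
    ultimately show "h \<in> {{1..n}, K}" by blast
  qed
  then have "card HE \<le> card {{1..n}, K}" by (intro card_mono) auto
  also have "\<dots> \<le> 2" by (simp add: card_insert_if)
  finally show False using cHE E4 by simp
qed

section \<open>Attaining the lower bound\<close>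

text \<open>Here the minimum is 0. \<open>Hnm\<close> always contains the full hyperedge, so this
  case is served by the empty hypergraph instead.\<close>

lemma single_edge_saturated:
  assumes G: "simple_graph V E" and Vn: "card V \<le> n" and E: "E = {e}"
  shows "Berge_saturated n V E {}"
proof -
  have "contains_Berge V E {1..n} {S}" if S: "S \<subseteq> {1..n}" "2 \<le> card S" for S
  proof -
    obtain f where "inj_on f V" "f ` V \<subseteq> {1..n}" "f ` e \<subseteq> S"
      using exists_embedding_edge[of V "{1..n}" e S] G Vn S E by (auto simp: simple_graph_def)
    then show ?thesis unfolding contains_Berge_def E
      by (intro exI[of _ f] exI[of _ "\<lambda>_. S"]) auto
  qed
  then show ?thesis unfolding Berge_saturated_def is_hypergraph_def contains_Berge_def E by auto
qed

lemma exists_saturated_card: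
  fixes V :: "'a set" and E :: "'a set set"
  assumes G: "simple_graph V E" and Vn: "card V \<le> n" and "E \<noteq> {}"
    and nstar: "4 \<le> card E \<Longrightarrow> \<not> (\<exists>c. \<forall>e\<in>E. c \<in> e)"
  shows "\<exists>HE. Berge_saturated n V E HE \<and> card HE = card E - 1"
proof (cases "2 \<le> card E")
  case True
  let ?x = "min (card E - 2) n"
  have "card ((\<lambda>i. {i}) ` {1..n}) = n" by (simp add: card_image)
  then obtain V' where V': "V' \<subseteq> (\<lambda>i. {i}) ` {1..n}" "card V' = ?x"
    by (metis min.cobounded2 obtain_subset_with_card_n)
  have "card E \<le> card {1..n} choose 2"
    using G Vn by (intro card_edges_le[of V]) (auto simp: simple_graph_def)
  also have "\<dots> = card {S. S \<subseteq> {1..n} \<and> card S = 2}" by (rule n_subsets[symmetric]) simp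
  finally have le: "card E - 2 - ?x \<le> card {S. S \<subseteq> {1..n} \<and> card S = 2}" by linarith
  obtain E' where E': "E' \<subseteq> {S. S \<subseteq> {1..n} \<and> card S = 2}" "card E' = card E - 2 - ?x"
    by (rule obtain_subset_with_card_n[OF le])
  have "Berge_saturated n V E (Hnm n V' E') \<and> card (Hnm n V' E') = card E - 1"
    using V' E' True by (intro Hnm_saturated[OF G Vn True nstar]) auto
  then show ?thesis by blast
next
  case False
  have "finite E" using G unfolding simple_graph_def by (meson PowI finite_Pow_iff finite_subset subsetI)
  then have "card E = 1" using False \<open>E \<noteq> {}\<close> by (metis One_nat_def card_0_eq less_2_cases not_less)
  then obtain e where "E = {e}" by (auto simp: card_1_singleton_iff)
  then show ?thesis using single_edge_saturated[OF G Vn] \<open>card E = 1\<close> by (intro exI[of _ "{}"]) auto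
qed

theorem theorem1:
  fixes V :: "'a set" and E :: "'a set set" and n :: nat
  assumes "simple_graph V E" and "no_isolated V E" and "E \<noteq> {}"
    and "card V \<le> n"
  shows "sat n V E = (if is_star V E \<and> 4 \<le> card E then card E else card E - 1)
         \<and> (is_star V E \<and> 4 \<le> card E \<longrightarrow> Berge_saturated n V E (H_t (card V) n))
         \<and> (\<not> (is_star V E \<and> 4 \<le> card E) \<and> 2 \<le> card E \<longrightarrow>
              (\<forall>V' E'. valid_Hnm_choice n (card E - 1) V' E' \<longrightarrow>
                 Berge_saturated n V E (Hnm n V' E')))"
proof (cases "is_star V E \<and> 4 \<le> card E")
  case True
  then obtain c where c: "c \<in> V" "\<forall>e\<in>E. c \<in> e" by (auto simp: is_star_def)
  have H: "Berge_saturated n V E (H_t (card V) n)" "card (H_t (card V) n) = card E"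
    using H_t_saturated[OF assms(1,2,4) _ c] True by auto
  have "sat n V E = card E" unfolding sat_def
  proof (rule Least_equality)
    show "\<exists>HE. Berge_saturated n V E HE \<and> card HE = card E" using H by blast
    show "card E \<le> k" if "\<exists>HE. Berge_saturated n V E HE \<and> card HE = k" for k
      using that star_saturated_card_ge[OF assms(1,4) _ c(2)] True by blast
  qed
  then show ?thesis using True H by simp
next
  case False
  \<comment> \<open>\<open>is_star\<close> asks for a centre in \<open>V\<close>; since
    \<open>E\<close> is nonempty, a vertex common to all edges lies in \<open>V\<close>
    automatically.\<close>
  have nstar: "\<not> (\<exists>c. \<forall>e\<in>E. c \<in> e)" if "4 \<le> card E"
  proof
    assume "\<exists>c. \<forall>e\<in>E. c \<in> e"
    then obtain c where c: "\<forall>e\<in>E. c \<in> e" by blast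
    then have "c \<in> V" using assms(1,3) by (auto simp: simple_graph_def)
    then show False using False that c by (auto simp: is_star_def)
  qed
  have "sat n V E = card E - 1" unfolding sat_def
  proof (rule Least_equality)
    show "\<exists>HE. Berge_saturated n V E HE \<and> card HE = card E - 1"
      using exists_saturated_card[OF assms(1,4,3) nstar] .
    show "card E - 1 \<le> k" if "\<exists>HE. Berge_saturated n V E HE \<and> card HE = k" for k
      using that Berge_saturated_card_ge[OF assms(1,4)] by blast
  qed
  moreover have "Berge_saturated n V E (Hnm n V' E')"
    if "2 \<le> card E" and ch: "valid_Hnm_choice n (card E - 1) V' E'" for V' E'
  proof -
    have V': "V' \<subseteq> {{i} | i. i \<in> {1..n}}" "card V' = min (card E - 2) n"
      and E': "\<forall>e\<in>E'. e \<subseteq> {1..n} \<and> card e = 2" "card E' = card E - 2 - card V'"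
      using ch by (simp_all add: valid_Hnm_choice_def Hnm_x_def almost_regular_on_def numeral_2_eq_2)
    have "Berge_saturated n V E (Hnm n V' E') \<and> card (Hnm n V' E') = card E - 1"
      using V' E' that(1) by (intro Hnm_saturated[OF assms(1,4) that(1) nstar]) auto
    then show ?thesis ..
  qed
  ultimately show ?thesis using False by auto
qed

end
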